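(* Let $s\in(1,\infty)$. Define, for $\lambda\in(0,\infty)$, $$f_{\lambda|s}(\lambda)=\frac{1}{\zeta(s)\,\Gamma(s)}\int_0^\infty\frac{1}{y+1}\,\bigl(\ln(y+1)\bigr)^{s-1}e^{-\lambda y}\,dy.$$ Then $f_{\lambda|s}$ is a probability density function on $(0,\infty)$, and the $\mathrm{Zeta}(s)$ distribution is the mixture of the $\mathrm{Poisson}(\lambda)$ distributions with mixing density $f_{\lambda|s}$; that is, for every $x\in\{0,1,2,\ldots\}$, $$\int_0^\infty \frac{e^{-\lambda}\lambda^x}{x!}\,f_{\lambda|s}(\lambda)\,d\lambda=\frac{(x+1)^{-s}}{\zeta(s)}.$$ Moreover, this mixing distribution is unique: if $\mu$ is a probability measure on $(0,\infty)$ such that $\int_{(0,\infty)}\frac{e^{-\lambda}\lambda^x}{x!}\,\mu(d\lambda)=\frac{(x+1)^{-s}}{\zeta(s)}$ for every $x\in\{0,1,2,\ldots\}$, then $\mu$ is the probability measure with density $f_{\lambda|s}$.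
   Context: $\zeta(s)=\sum_{x=0}^{\infty}(x+1)^{-s}$ is the Riemann zeta function (for $s>1$) and $\Gamma$ is the Gamma function. The $\mathrm{Zeta}(s)$ distribution, $s\in(1,\infty)$, is the distribution on $\{0,1,2,\ldots\}$ with probability mass function $\frac{(x+1)^{-s}}{\zeta(s)}$. *)

theory Defs
  imports "HOL-Probability.Probability"
begin

text \<open>Only meaningful for \<open>s > 1\<close>, where the series converges.\<close>

definition real_zeta :: "real \<Rightarrow> real" where
  "real_zeta s = (\<Sum>x. real (x + 1) powr (-s))"

lemma summable_real_zeta:
  assumes "s > 1"
  shows "summable (\<lambda>x. real (x + 1) powr (-s))"
  using assms summable_real_powr_iff[of "-s"]
  by (subst summable_iff_shift[of "\<lambda>n. real n powr (-s)" 1]) simp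

lemma real_zeta_pos:
  assumes "s > 1"
  shows "real_zeta s > 0"
  unfolding real_zeta_def using summable_real_zeta[OF assms] by (intro suminf_pos) auto

definition zeta_pmf :: "real \<Rightarrow> nat pmf" where
  "zeta_pmf s = embed_pmf (\<lambda>x. real (x + 1) powr (-s) / real_zeta s)"

lemma pmf_zeta:
  assumes "s > 1"
  shows "pmf (zeta_pmf s) x = real (x + 1) powr (-s) / real_zeta s"
  unfolding zeta_pmf_def
proof (rule pmf_embed_pmf)
  have pos: "real_zeta s > 0" and sm: "summable (\<lambda>x. real (x + 1) powr (-s))"
    using assms by (rule real_zeta_pos, rule summable_real_zeta)
  show nonneg: "real (x + 1) powr (-s) / real_zeta s \<ge> 0" for x :: nat
    using pos by simp
  have "(\<Sum>x. real (x + 1) powr (-s) / real_zeta s) = real_zeta s / real_zeta s"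
    unfolding real_zeta_def by (rule suminf_divide[OF sm])
  then have "(\<Sum>x. real (x + 1) powr (-s) / real_zeta s) = 1"
    using pos by simp
  then show "(\<integral>\<^sup>+x. ennreal (real (x + 1) powr (-s) / real_zeta s) \<partial>count_space UNIV) = 1"
    by (subst nn_integral_count_space_nat,
        subst suminf_ennreal2[OF nonneg summable_divide[OF sm]]) (simp_all only: ennreal_1)
qed

definition zeta_mixing_integrand :: "real \<Rightarrow> real \<Rightarrow> real \<Rightarrow> real" where
  "zeta_mixing_integrand s l y = 1 / (y + 1) * ln (y + 1) powr (s - 1) * exp (- l * y)"

definition zeta_mixing_density :: "real \<Rightarrow> real \<Rightarrow> real" where
  "zeta_mixing_density s l =
     1 / (real_zeta s * Gamma s) * (LINT y:{0<..}|lborel. zeta_mixing_integrand s l y)"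

definition is_pdf_on :: "real set \<Rightarrow> (real \<Rightarrow> real) \<Rightarrow> bool" where
  "is_pdf_on A f \<longleftrightarrow>
     (\<forall>x\<in>A. 0 \<le> f x) \<and> set_integrable lborel A f \<and> (LINT x:A|lborel. f x) = 1"

end

theory Submission
  imports Defs
begin

text \<open>
  The \<open>x\<close>-th Poisson probability integrates an exponential \<open>exp (- l * y)\<close> in \<open>l\<close>
  to \<open>(y + 1) powr - (x + 1)\<close>. Since the density is, up to the factor
  \<open>1 / (\<zeta>(s) \<Gamma>(s))\<close>, a superposition of such exponentials with weight
  \<open>ln (y + 1) powr (s - 1) / (y + 1)\<close>, Tonelli's theorem reduces the mixture to the integral
  of that weight against \<open>(y + 1) powr - (x + 1)\<close>, which the substitution
  \<open>y = exp (u / (x + 1)) - 1\<close> turns into Euler's integral for \<open>\<Gamma>(s)\<close>, leaving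
  \<open>(x + 1) powr -s / \<zeta>(s)\<close>
  (\<open>nn_integral_mixing_weight_powr\<close>, \<open>nn_integral_poisson_mixture\<close>).
  Poisson probabilities add up to 1, so summing these identities over \<open>x\<close> gives the total mass
  of the density: it is the sum of the Zeta probabilities.

  For uniqueness, the Poisson mixture of a measure determines the integrals of
  \<open>exp (-l) * l ^ x\<close>, that is, the Taylor coefficients at 1 of the Laplace transform. The
  transform is holomorphic in the right half plane, and its Taylor series at \<open>a\<close> converges to
  it on the disc of radius \<open>Re a\<close> about \<open>a\<close>, so overlapping discs carry the
  information from 1 to every point of the half plane
  (\<open>laplace_moment_expansion\<close>, \<open>laplace_moment_eq_everywhere\<close>). The limit at the imaginary
  axis is the characteristic function, and Levy's uniqueness theorem identifies the measure.
\<close>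

section \<open>The mixing density and its Poisson integrals\<close>

definition mixing_weight :: "real \<Rightarrow> real \<Rightarrow> real" where
  "mixing_weight s y = indicator {0<..} y * (ln (y + 1) powr (s - 1) / (y + 1))"

lemma mixing_weight_nonneg [simp]: "0 \<le> mixing_weight s y"
  by (auto simp: mixing_weight_def split: split_indicator)

lemma measurable_mixing_weight [measurable]: "mixing_weight s \<in> borel_measurable borel"
  unfolding mixing_weight_def by measurable

text \<open>
  The substitution \<open>y = exp (u / c) - 1\<close> turns the integrand into
  \<open>c powr -s\<close> times that of Euler's integral for \<open>\<Gamma>(s)\<close>. Taking \<open>c = x + 1\<close> yields the
  Zeta probabilities; \<open>c = 1\<close> serves as the integrable bound for the mixing integrand.
\<close>

lemma nn_integral_mixing_weight_powr:
  assumes s: "s > 0" and c: "c > 0"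
  shows "(\<integral>\<^sup>+y. ennreal (mixing_weight s y * (y + 1) powr (-c)) \<partial>lborel)
    = ennreal (Gamma s * c powr (-s))"
proof -
  define f where "f y = ln (y + 1) powr (s - 1) / (y + 1) * (y + 1) powr (-c)" for y :: real
  define g where "g u = exp (u / c) - 1" for u :: real
  define g' where "g' u = exp (u / c) / c" for u :: real
  have img: "g ` {0<..} = {0<..}"
  proof (intro equalityI subsetI)
    fix y :: real assume "y \<in> {0<..}"
    then show "y \<in> g ` {0<..}" using c
      by (intro image_eqI[of _ _ "c * ln (y + 1)"]) (auto simp: g_def)
  qed (use c in \<open>auto simp: g_def\<close>)
  have inj: "inj_on g {0<..}"
    using c by (auto simp: inj_on_def g_def)
  have der: "(g has_field_derivative g' u) (at u within {0<..})" for u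
    unfolding g_def g'_def using c by (auto intro!: derivative_eq_intros)
  have pull: "\<bar>g' u\<bar> * f (g u) = c powr (-s) * (u powr (s - 1) / exp u)" if "u \<in> {0<..}" for u
  proof -
    have "\<bar>g' u\<bar> * f (g u) = (u / c) powr (s - 1) / c * exp (-u)"
      using c by (simp add: g'_def g_def f_def exp_powr_real)
    also have "(u / c) powr (s - 1) / c = c powr (-s) * u powr (s - 1)"
      using c that by (simp add: powr_divide powr_diff powr_minus field_simps)
    finally show ?thesis by (simp add: exp_minus field_simps)
  qed
  have "((\<lambda>t. t powr (s - 1) / exp t) has_integral Gamma s) {0<..}"
    using Gamma_integral_real[OF s]
    by (rule has_integral_spike_set_eq[THEN iffD1, rotated 2])
       (auto intro: negligible_subset[of "{0}"])
  then have gam: "((\<lambda>t. c powr (-s) * (t powr (s - 1) / exp t)) has_integral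
      c powr (-s) * Gamma s) {0<..}"
    by (rule has_integral_mult_right)
  then have pb: "((\<lambda>u. \<bar>g' u\<bar> * f (g u)) has_integral c powr (-s) * Gamma s) {0<..}"
    by (rule has_integral_eq[rotated]) (use pull in auto)
  have "(\<lambda>u. \<bar>g' u\<bar> * f (g u)) absolutely_integrable_on {0<..}"
    using pb by (intro nonnegative_absolutely_integrable_1)
      (auto simp: f_def g_def integrable_on_def)
  with pb have "f absolutely_integrable_on (g ` {0<..}) \<and>
      integral (g ` {0<..}) f = c powr (-s) * Gamma s"
    using has_absolute_integral_change_of_variables_1'[OF _ der inj, of f "c powr (-s) * Gamma s"]
    by (auto simp: integral_unique)
  then have "(f has_integral c powr (-s) * Gamma s) {0<..}"
    unfolding img using set_lebesgue_integral_eq_integral(1) has_integral_integrable_integral by blast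
  then have "integral\<^sup>N lborel (\<lambda>y. ennreal (f y) * indicator {0<..} y)
      = ennreal (c powr (-s) * Gamma s)"
    by (intro nn_integral_has_integral_lebesgue') (simp add: f_def, assumption)
  moreover have "ennreal (mixing_weight s y * (y + 1) powr (-c))
      = ennreal (f y) * indicator {0<..} y" for y
    by (auto simp: mixing_weight_def f_def split: split_indicator)
  ultimately show ?thesis by (simp add: mult.commute)
qed

text \<open>
  Up to the factor on the right, the integrand is the Gamma density with shape
  \<open>x + 1\<close> and rate \<open>y + 1\<close>, known as an Erlang density because the shape is an integer.
\<close>

lemma nn_integral_gamma_kernel:
  assumes y: "y > -1"
  shows "(\<integral>\<^sup>+l. ennreal (indicator {0<..} l * (exp (-l) * l ^ x / fact x * exp (- l * y))) \<partial>lborel)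
    = ennreal ((y + 1) powr (- (real x + 1)))"
proof -
  interpret prob_space "density lborel (erlang_density x (y + 1))"
    by (rule prob_space_erlang_density) (use y in simp)
  have one: "(\<integral>\<^sup>+l. ennreal (erlang_density x (y + 1) l) \<partial>lborel) = 1"
    using emeasure_space_1 by (simp add: emeasure_density)
  define C where "C = (y + 1) powr (- (real x + 1))"
  have "C = inverse ((y + 1) powr real (Suc x))"
    unfolding C_def powr_minus[symmetric] by (simp add: add.commute)
  then have C: "C * (y + 1) ^ Suc x = 1"
    using y by (subst (asm) powr_realpow) (simp_all del: power_Suc)
  have pt: "indicator {0<..} l * (exp (-l) * l ^ x / fact x * exp (- l * y))
      = C * erlang_density x (y + 1) l" if "l \<noteq> 0" for l
  proof (cases "l > 0")
    case True
    have "C * erlang_density x (y + 1) l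
        = (C * (y + 1) ^ Suc x) * (l ^ x * exp (- (y + 1) * l) / fact x)"
      using True by (simp add: erlang_density_def del: power_Suc)
    also have "exp (- (y + 1) * l) = exp (-l) * exp (- l * y)"
      by (simp add: algebra_simps flip: exp_add)
    finally show ?thesis
      using True by (simp add: C del: power_Suc)
  qed (use that in \<open>simp add: erlang_density_def\<close>)
  have "(\<integral>\<^sup>+l. ennreal (indicator {0<..} l * (exp (-l) * l ^ x / fact x * exp (- l * y))) \<partial>lborel)
      = (\<integral>\<^sup>+l. ennreal C * ennreal (erlang_density x (y + 1) l) \<partial>lborel)"
  proof (intro nn_integral_cong_AE)
    have "C \<ge> 0" by (simp add: C_def)
    then show "AE l in lborel. ennreal (indicator {0<..} l * (exp (-l) * l ^ x / fact x * exp (- l * y)))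
        = ennreal C * ennreal (erlang_density x (y + 1) l)"
      by (intro eventually_mono[OF AE_lborel_singleton[of "0::real"]])
        (subst pt, assumption, rule ennreal_mult')
  qed
  also have "\<dots> = ennreal C"
    by (simp add: nn_integral_cmult one)
  finally show ?thesis by (simp add: C_def)
qed

lemma mixing_integrand_eq_weight:
  "indicator {0<..} y * zeta_mixing_integrand s l y = mixing_weight s y * exp (- l * y)"
  by (simp add: zeta_mixing_integrand_def mixing_weight_def)

text \<open>
  The trade of exponential for polynomial decay that lets the mixing integrand be
  compared with an integral already evaluated.
\<close>

lemma exp_minus_le_inverse:
  fixes l y :: real
  assumes l: "l > 0" and y: "y > 0"
  shows "exp (- l * y) \<le> 1 / min l 1 * (y + 1) powr (-1)"
proof -
  define c where "c = min l 1"
  have c: "0 < c" "c \<le> 1" "c \<le> l" using l by (auto simp: c_def)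
  have "c * (y + 1) \<le> 1 + c * y" using c by (simp add: algebra_simps)
  also have "\<dots> \<le> exp (c * y)" by (rule exp_ge_add_one_self)
  also have "\<dots> \<le> exp (l * y)" using c y by simp
  finally show ?thesis
    using c y unfolding c_def[symmetric]
    by (simp add: exp_minus powr_minus inverse_eq_divide pos_divide_le_eq pos_le_divide_eq)
qed

lemma set_integrable_mixing_integrand:
  assumes s: "s > 0" and l: "l > 0"
  shows "set_integrable lborel {0<..} (zeta_mixing_integrand s l)"
proof -
  define C where "C = 1 / min l 1"
  have C: "C \<ge> 0" using l by (simp add: C_def)
  have w0: "mixing_weight s y = 0" if "y \<le> 0" for y
    using that by (simp add: mixing_weight_def)
  have "(\<integral>\<^sup>+y. ennreal (mixing_weight s y * exp (- l * y)) \<partial>lborel)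
      \<le> (\<integral>\<^sup>+y. ennreal C * ennreal (mixing_weight s y * (y + 1) powr (-1)) \<partial>lborel)"
  proof (intro nn_integral_mono)
    fix y :: real
    show "ennreal (mixing_weight s y * exp (- l * y))
        \<le> ennreal C * ennreal (mixing_weight s y * (y + 1) powr (-1))"
    proof (cases "y > 0")
      case True
      have "mixing_weight s y * exp (- l * y) \<le> mixing_weight s y * (C * (y + 1) powr (-1))"
        unfolding C_def by (intro mult_left_mono exp_minus_le_inverse l True) simp
      then show ?thesis
        using C by (subst ennreal_mult'[symmetric]) (auto intro!: ennreal_leI simp only: mult.left_commute)
    qed (simp add: w0)
  qed
  also have "\<dots> = ennreal C * (\<integral>\<^sup>+y. ennreal (mixing_weight s y * (y + 1) powr (-1)) \<partial>lborel)"
    by (rule nn_integral_cmult) measurable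
  also have "\<dots> < \<infinity>"
    using nn_integral_mixing_weight_powr[OF s, of 1] by (simp add: ennreal_mult_less_top)
  finally have "integrable lborel (\<lambda>y. mixing_weight s y * exp (- l * y))"
    by (intro integrableI_nonneg) auto
  then show ?thesis
    by (simp add: set_integrable_def mixing_integrand_eq_weight)
qed

context
  fixes s :: real
  assumes s: "s > 1"
begin

lemma zeta_Gamma_pos: "real_zeta s * Gamma s > 0"
  using s by (simp add: real_zeta_pos Gamma_real_pos)

lemma zeta_mixing_density_nonneg: "0 \<le> zeta_mixing_density s l"
proof -
  have "0 \<le> (LINT y:{0<..}|lborel. zeta_mixing_integrand s l y)"
    unfolding set_lebesgue_integral_def
    by (intro Bochner_Integration.integral_nonneg)
      (simp add: mixing_integrand_eq_weight)
  then show ?thesis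
    using zeta_Gamma_pos by (simp add: zeta_mixing_density_def)
qed

lemma measurable_zeta_mixing_density [measurable]:
  "zeta_mixing_density s \<in> borel_measurable borel"
  unfolding zeta_mixing_density_def set_lebesgue_integral_def zeta_mixing_integrand_def
  by measurable

lemma zeta_mixing_density_eq_nn_integral:
  assumes l: "l > 0"
  shows "ennreal (zeta_mixing_density s l) = ennreal (1 / (real_zeta s * Gamma s)) *
    (\<integral>\<^sup>+y. ennreal (mixing_weight s y * exp (- l * y)) \<partial>lborel)"
proof -
  have "integrable lborel (\<lambda>y. mixing_weight s y * exp (- l * y))"
    using set_integrable_mixing_integrand[of s l] s l
    by (simp add: set_integrable_def mixing_integrand_eq_weight)
  then have "(\<integral>\<^sup>+y. ennreal (mixing_weight s y * exp (- l * y)) \<partial>lborel)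
      = ennreal (LINT y:{0<..}|lborel. zeta_mixing_integrand s l y)"
    by (subst nn_integral_eq_integral)
      (auto simp: set_lebesgue_integral_def mixing_integrand_eq_weight)
  then show ?thesis
    using zeta_Gamma_pos by (simp add: zeta_mixing_density_def ennreal_mult'[symmetric])
qed

text \<open>
  Everything is nonnegative, so the order of integration may be exchanged before any
  integrability of the density over \<open>l\<close> is known. Stated for the extended nonnegative integral
  because that is the form in which the total mass is then obtained by summation.
\<close>

lemma nn_integral_poisson_mixture:
  "(\<integral>\<^sup>+l. ennreal (indicator {0<..} l * (exp (-l) * l ^ x / fact x * zeta_mixing_density s l)) \<partial>lborel)
    = ennreal (real (x + 1) powr (-s) / real_zeta s)"
proof -
  define K where "K = 1 / (real_zeta s * Gamma s)"
  define p where "p l = indicator {0<..} l * (exp (-l) * l ^ x / fact x)" for l :: real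
  have p0: "p l \<ge> 0" for l by (auto simp: p_def split: split_indicator)
  have [measurable]: "p \<in> borel_measurable borel" unfolding p_def by measurable
  have K: "K \<ge> 0" using zeta_Gamma_pos by (simp add: K_def)
  have w0: "mixing_weight s y = 0" if "y \<le> 0" for y
    using that by (simp add: mixing_weight_def)
  have "ennreal (indicator {0<..} l * (exp (-l) * l ^ x / fact x * zeta_mixing_density s l))
      = ennreal K * (\<integral>\<^sup>+y. ennreal (p l) * ennreal (mixing_weight s y * exp (- l * y)) \<partial>lborel)" for l
  proof (cases "l > 0")
    case True
    have "ennreal (indicator {0<..} l * (exp (-l) * l ^ x / fact x * zeta_mixing_density s l))
       = ennreal (p l) * ennreal (zeta_mixing_density s l)"
      using p0 by (simp add: p_def ennreal_mult'[symmetric] mult.assoc zeta_mixing_density_nonneg ennreal_mult''[symmetric])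
    then show ?thesis
      by (simp add: zeta_mixing_density_eq_nn_integral True nn_integral_cmult K_def mult.left_commute)
  qed (simp add: p_def)
  then have "(\<integral>\<^sup>+l. ennreal (indicator {0<..} l * (exp (-l) * l ^ x / fact x * zeta_mixing_density s l)) \<partial>lborel)
     = ennreal K * (\<integral>\<^sup>+l. (\<integral>\<^sup>+y. ennreal (p l) * ennreal (mixing_weight s y * exp (- l * y)) \<partial>lborel) \<partial>lborel)"
    by (simp add: nn_integral_cmult)
  also have "(\<integral>\<^sup>+l. (\<integral>\<^sup>+y. ennreal (p l) * ennreal (mixing_weight s y * exp (- l * y)) \<partial>lborel) \<partial>lborel)
     = (\<integral>\<^sup>+y. (\<integral>\<^sup>+l. ennreal (p l) * ennreal (mixing_weight s y * exp (- l * y)) \<partial>lborel) \<partial>lborel)"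
    by (rule lborel_pair.Fubini') measurable
  also have "\<dots> = (\<integral>\<^sup>+y. ennreal (mixing_weight s y * (y + 1) powr (- (real x + 1))) \<partial>lborel)"
  proof (rule nn_integral_cong)
    fix y :: real
    show "(\<integral>\<^sup>+l. ennreal (p l) * ennreal (mixing_weight s y * exp (- l * y)) \<partial>lborel)
       = ennreal (mixing_weight s y * (y + 1) powr (- (real x + 1)))"
    proof (cases "y > 0")
      case True
      have "(\<integral>\<^sup>+l. ennreal (p l) * ennreal (mixing_weight s y * exp (- l * y)) \<partial>lborel)
        = (\<integral>\<^sup>+l. ennreal (mixing_weight s y) * ennreal (p l * exp (- l * y)) \<partial>lborel)"
        using p0 by (simp add: ennreal_mult'[symmetric] mult.left_commute)
      also have "\<dots> = ennreal (mixing_weight s y) * (\<integral>\<^sup>+l. ennreal (p l * exp (- l * y)) \<partial>lborel)"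
        by (rule nn_integral_cmult) measurable
      also have "(\<integral>\<^sup>+l. ennreal (p l * exp (- l * y)) \<partial>lborel) = ennreal ((y + 1) powr (- (real x + 1)))"
        using nn_integral_gamma_kernel[of y x] True by (simp add: p_def mult.assoc)
      finally show ?thesis by (simp add: ennreal_mult'[symmetric])
    qed (simp add: w0)
  qed
  also have "\<dots> = ennreal (Gamma s * (real x + 1) powr (-s))"
    using s by (intro nn_integral_mixing_weight_powr) auto
  also have "ennreal K * \<dots> = ennreal (real (x + 1) powr (-s) / real_zeta s)"
    using K less_imp_neq[OF Gamma_real_pos[of s]] s
    by (subst ennreal_mult'[symmetric]) (auto simp: K_def add.commute)
  finally show ?thesis .
qed

lemma poisson_mixture_integral:
  "(LINT l:{0<..}|lborel. exp (-l) * l ^ x / fact x * zeta_mixing_density s l)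
    = real (x + 1) powr (-s) / real_zeta s"
  unfolding set_lebesgue_integral_def real_scaleR_def
  using zeta_mixing_density_nonneg real_zeta_pos[OF s]
  by (subst integral_eq_nn_integral)
     (auto simp: nn_integral_poisson_mixture[simplified] intro!: AE_I2 split: split_indicator)

text \<open>
  Splitting the constant 1 into the Poisson probabilities reduces the total mass to the
  series that defines \<open>\<zeta>(s)\<close>.
\<close>

lemma nn_integral_zeta_mixing_density:
  "(\<integral>\<^sup>+l. ennreal (indicator {0<..} l * zeta_mixing_density s l) \<partial>lborel) = 1"
proof -
  have "ennreal (indicator {0<..} l * zeta_mixing_density s l) =
     (\<Sum>x. ennreal (indicator {0<..} l * (exp (-l) * l ^ x / fact x * zeta_mixing_density s l)))" for l :: real
  proof (cases "l > 0")
    case True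
    have "(\<lambda>x. l ^ x /\<^sub>R fact x) sums exp l" by (rule exp_converges)
    then have "(\<lambda>x. (exp (-l) * zeta_mixing_density s l) * (l ^ x /\<^sub>R fact x)) sums
        ((exp (-l) * zeta_mixing_density s l) * exp l)"
      by (rule sums_mult)
    then have "(\<lambda>x. exp (-l) * l ^ x / fact x * zeta_mixing_density s l) sums zeta_mixing_density s l"
      by (simp add: exp_minus field_simps)
    then have "(\<Sum>x. ennreal (exp (-l) * l ^ x / fact x * zeta_mixing_density s l))
        = ennreal (zeta_mixing_density s l)"
      using True zeta_mixing_density_nonneg
      by (subst suminf_ennreal2) (auto simp: sums_iff)
    then show ?thesis using True by simp
  qed simp
  then have "(\<integral>\<^sup>+l. ennreal (indicator {0<..} l * zeta_mixing_density s l) \<partial>lborel)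
     = (\<integral>\<^sup>+l. (\<Sum>x. ennreal (indicator {0<..} l *
          (exp (-l) * l ^ x / fact x * zeta_mixing_density s l))) \<partial>lborel)"
    by simp
  also have "\<dots> = (\<Sum>x. ennreal (real (x + 1) powr (-s) / real_zeta s))"
    by (subst nn_integral_suminf) (simp_all only: nn_integral_poisson_mixture, measurable)
  also have "\<dots> = ennreal (\<Sum>x. real (x + 1) powr (-s) / real_zeta s)"
    using s real_zeta_pos[OF s] by (intro suminf_ennreal2 summable_divide summable_real_zeta) auto
  also have "(\<Sum>x. real (x + 1) powr (-s) / real_zeta s) = 1"
    using suminf_divide[OF summable_real_zeta[OF s], of "real_zeta s"] real_zeta_pos[OF s]
    by (simp add: real_zeta_def)
  finally show ?thesis by simp
qed

lemma is_pdf_on_zeta_mixing_density: "is_pdf_on {0<..} (zeta_mixing_density s)"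
proof -
  have "has_bochner_integral lborel (\<lambda>l. indicator {0<..} l * zeta_mixing_density s l) 1"
    using nn_integral_zeta_mixing_density zeta_mixing_density_nonneg
    by (intro has_bochner_integral_nn_integral) (auto split: split_indicator)
  then show ?thesis
    using zeta_mixing_density_nonneg
    by (auto simp: is_pdf_on_def set_integrable_def set_lebesgue_integral_def
        has_bochner_integral_iff)
qed

end

section \<open>Uniqueness of Poisson mixtures\<close>

lemma borel_measurable_on_positives:
  assumes "sets M = sets (restrict_space borel {0::real<..})" "f \<in> borel_measurable borel"
  shows "f \<in> borel_measurable M"
  using assms(2) measurable_restrict_space1 measurable_cong_sets[OF assms(1) refl] by blast

lemma space_on_positives:
  assumes "sets M = sets (restrict_space borel {0::real<..})"
  shows "space M = {0<..}"
  using sets_eq_imp_space_eq[OF assms] by (simp add: space_restrict_space)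

lemma power_times_exp_minus_le:
  fixes l c :: real
  assumes "c > 0" "l \<ge> 0"
  shows "l ^ x * exp (- c * l) \<le> fact x / c ^ x"
proof -
  have "(c * l) ^ x / fact x \<le> exp (c * l)"
  proof -
    have "(c * l) ^ x /\<^sub>R fact x \<le> (\<Sum>n. (c * l) ^ n /\<^sub>R fact n)"
      using assms summable_exp_generic[of "c * l"]
        sum_le_suminf[of "\<lambda>n. (c * l) ^ n /\<^sub>R fact n" "{x}"] by simp
    then show ?thesis by (simp add: exp_def field_simps)
  qed
  then show ?thesis
    using assms by (simp add: exp_minus field_simps power_mult_distrib)
qed

text \<open>
  Up to the sign \<open>(-1) ^ x\<close>, the \<open>x\<close>-th derivative of the Laplace transform of \<open>M\<close>
  at \<open>a\<close>; the direct formula avoids differentiating under the integral.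
\<close>

definition laplace_moment :: "real measure \<Rightarrow> complex \<Rightarrow> nat \<Rightarrow> complex" where
  "laplace_moment M a x = (CLINT l|M. exp (- a * of_real l) * of_real l ^ x)"

lemma integrable_power_times_exp_minus:
  assumes fin: "finite_measure M" and sets: "sets M = sets (restrict_space borel {0<..})"
    and c: "c > (0::real)"
  shows "integrable M (\<lambda>l. l ^ x * exp (- c * l))"
proof (rule finite_measure.integrable_const_bound[OF fin, of _ "fact x / c ^ x"])
  show "AE l in M. norm (l ^ x * exp (- c * l)) \<le> fact x / c ^ x"
    using power_times_exp_minus_le[OF c] space_on_positives[OF sets]
    by (intro AE_I2) (auto simp: abs_mult)
qed (rule borel_measurable_on_positives[OF sets], measurable)

lemma integrable_laplace_moment:
  assumes "finite_measure M" and sets: "sets M = sets (restrict_space borel {0<..})"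
    and "Re a > 0"
  shows "integrable M (\<lambda>l. exp (- a * of_real l) * of_real l ^ x)"
proof (rule Bochner_Integration.integrable_bound
      [OF integrable_power_times_exp_minus[OF assms, of x]])
  show "AE l in M. norm (exp (- a * of_real l) * of_real l ^ x) \<le> norm (l ^ x * exp (- Re a * l))"
    using space_on_positives[OF sets]
    by (intro AE_I2) (auto simp: norm_mult norm_power)
qed (rule borel_measurable_on_positives[OF sets], measurable)

lemma norm_exp_partial_sum_le:
  fixes z :: complex
  shows "norm (\<Sum>k<n. z ^ k / fact k) \<le> exp (norm z)"
proof -
  have "norm (\<Sum>k<n. z ^ k / fact k) \<le> (\<Sum>k<n. norm z ^ k /\<^sub>R fact k)"
    by (rule sum_norm_le) (simp add: norm_divide norm_power field_simps)
  also have "\<dots> \<le> (\<Sum>k. norm z ^ k /\<^sub>R fact k)"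
    by (intro sum_le_suminf summable_exp_generic) auto
  finally show ?thesis by (simp add: exp_def)
qed

text \<open>
  The Taylor expansion at \<open>a\<close> of (a derivative of) the Laplace transform, obtained by
  expanding \<open>exp (- d * l)\<close> under the integral. The partial sums are bounded by
  \<open>exp (norm d * l)\<close>, and \<open>norm d < Re a\<close> is what makes this majorant integrable against
  \<open>l ^ x * exp (- Re a * l)\<close>.
\<close>

lemma laplace_moment_expansion:
  assumes fin: "finite_measure M" and sets: "sets M = sets (restrict_space borel {0<..})"
    and d: "norm d < Re a"
  shows "(\<lambda>k. (-d) ^ k / fact k * laplace_moment M a (x + k)) sums laplace_moment M (a + d) x"
proof -
  define c where "c = Re a - norm d"
  have c: "c > 0" using d by (simp add: c_def)
  have a: "Re a > 0" using d norm_ge_zero[of d] by linarith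
  define h where "h n l = (\<Sum>k<n. (-d) ^ k / fact k * (exp (- a * of_real l) * of_real l ^ (x + k)))"
    for n and l :: real
  have h_eq: "h n l = exp (- a * of_real l) * of_real l ^ x * (\<Sum>k<n. (- d * of_real l) ^ k / fact k)" for n l
    unfolding h_def sum_distrib_left
    by (intro sum.cong refl) (simp only: power_mult_distrib power_add, simp add: field_simps)
  have "(\<lambda>n. CLINT l|M. h n l) \<longlonglongrightarrow> (CLINT l|M. exp (- (a + d) * of_real l) * of_real l ^ x)"
  proof (rule integral_dominated_convergence[where w = "\<lambda>l. l ^ x * exp (- c * l)"])
    show "AE l in M. (\<lambda>n. h n l) \<longlonglongrightarrow> exp (- (a + d) * of_real l) * of_real l ^ x"
    proof (intro AE_I2)
      fix l :: real
      have "(\<lambda>n. \<Sum>k<n. (- d * of_real l) ^ k / fact k) \<longlonglongrightarrow> exp (- d * of_real l)"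
        using exp_converges[of "- d * complex_of_real l"] by (simp add: sums_def scaleR_conv_of_real field_simps)
      then have "(\<lambda>n. h n l) \<longlonglongrightarrow> exp (- a * of_real l) * of_real l ^ x * exp (- d * of_real l)"
        unfolding h_eq by (rule tendsto_mult_left)
      also have "exp (- a * of_real l) * of_real l ^ x * exp (- d * of_real l)
          = exp (- (a + d) * of_real l) * of_real l ^ x"
        by (simp add: exp_add[symmetric] algebra_simps flip: exp_add)
      finally show "(\<lambda>n. h n l) \<longlonglongrightarrow> exp (- (a + d) * of_real l) * of_real l ^ x" .
    qed
    show "AE l in M. norm (h n l) \<le> l ^ x * exp (- c * l)" for n
    proof (intro AE_I2)
      fix l assume "l \<in> space M"
      then have l: "l > 0" using space_on_positives[OF sets] by simp
      have "norm (h n l) = exp (- Re a * l) * l ^ x * norm (\<Sum>k<n. (- d * of_real l) ^ k / fact k)"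
        using l by (simp only: h_eq norm_mult norm_power) simp
      also have "\<dots> \<le> exp (- Re a * l) * l ^ x * exp (norm (- d * of_real l))"
        using l by (intro mult_left_mono norm_exp_partial_sum_le) auto
      also have "\<dots> = l ^ x * exp (- c * l)"
        using l by (simp add: norm_mult c_def exp_add[symmetric] algebra_simps flip: exp_add)
      finally show "norm (h n l) \<le> l ^ x * exp (- c * l)" .
    qed
  qed (use integrable_power_times_exp_minus[OF fin sets c] in
        \<open>auto simp: h_def intro!: borel_measurable_on_positives[OF sets]\<close>)
  moreover have "(CLINT l|M. h n l) = (\<Sum>k<n. (-d) ^ k / fact k * laplace_moment M a (x + k))" for n
    unfolding h_def laplace_moment_def
    using integrable_laplace_moment[OF fin sets a]
    by (subst Bochner_Integration.integral_sum)
      (intro integrable_mult_right, assumption, simp)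
  ultimately show ?thesis
    by (simp add: sums_def laplace_moment_def)
qed

text \<open>
  Analytic continuation by discs: agreement of all moments at \<open>a\<close> passes to every point at
  distance less than \<open>Re a\<close>. Multiplying by \<open>3/2\<close> stays within this disc, so agreement spreads
  from 1 to arbitrarily large reals \<open>R\<close>; and the discs about \<open>R\<close> through 0 exhaust the
  right half plane, so one more step reaches any given point.
\<close>

lemma laplace_moment_eq_everywhere:
  assumes M: "finite_measure M" "sets M = sets (restrict_space borel {0<..})"
    and N: "finite_measure N" "sets N = sets (restrict_space borel {0<..})"
    and eq1: "\<And>x. laplace_moment M 1 x = laplace_moment N 1 x"
    and z: "Re z > 0"
  shows "laplace_moment M z x = laplace_moment N z x"
proof -
  have step: "laplace_moment M b y = laplace_moment N b y"
    if "\<And>x. laplace_moment M a x = laplace_moment N a x" "norm (b - a) < Re a" for a b y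
    using laplace_moment_expansion[OF M that(2), of y] laplace_moment_expansion[OF N that(2), of y]
    by (simp add: that(1) sums_iff)
  have pow: "laplace_moment M (of_real ((3/2) ^ n)) y = laplace_moment N (of_real ((3/2) ^ n)) y" for n y
  proof (induction n arbitrary: y)
    case (Suc n)
    have "complex_of_real ((3/2) ^ Suc n) - of_real ((3/2) ^ n) = of_real ((3/2) ^ n / 2)"
      by (simp flip: of_real_diff)
    then have dist: "norm (complex_of_real ((3/2) ^ Suc n) - of_real ((3/2) ^ n)) = (3/2) ^ n / 2"
      by (simp only: norm_of_real) simp
    show ?case
      by (rule step[where a = "of_real ((3/2) ^ n)", OF Suc.IH], subst dist) simp
  qed (use eq1 in simp)
  \<comment> \<open>The point \<open>z\<close> is closer than \<open>R\<close> to \<open>R\<close> exactly when \<open>(cmod z)\<^sup>2 < 2 * Re z * R\<close>.\<close>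
  obtain n where n: "(cmod z)\<^sup>2 / (2 * Re z) < (3/2) ^ n"
    using real_arch_pow[of "3/2"] by auto
  define R :: real where "R = (3/2) ^ n"
  have R: "R > 0" by (simp add: R_def)
  have "(cmod z)\<^sup>2 < 2 * Re z * R"
    using n z by (simp add: R_def field_simps)
  then have "(norm (z - of_real R))\<^sup>2 < R\<^sup>2"
    by (simp add: cmod_power2 power2_diff)
  then have "norm (z - of_real R) < Re (of_real R)"
    using R by (simp add: power_less_imp_less_base)
  then show ?thesis
    by (rule step[OF pow[of n, folded R_def]])
qed

text \<open>
  The imaginary axis bounds the region where the Laplace transforms are compared, so the
  characteristic function is approached from inside, dominated by the constant 1.
\<close>

lemma laplace_moment_tendsto_characteristic:
  assumes fin: "finite_measure M" and sets: "sets M = sets (restrict_space borel {0<..})"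
  shows "(\<lambda>n. laplace_moment M (of_real (1 / real (Suc n)) - \<i> * of_real t) 0)
    \<longlonglongrightarrow> (CLINT l|M. iexp (t * l))"
  unfolding laplace_moment_def
proof (rule integral_dominated_convergence[where w = "\<lambda>_. 1"])
  show "integrable M (\<lambda>_. 1 :: real)"
    using fin by (simp add: finite_measure.integrable_const)
  show "AE l in M. (\<lambda>n. exp (- (of_real (1 / real (Suc n)) - \<i> * of_real t) * of_real l) * of_real l ^ 0)
      \<longlonglongrightarrow> iexp (t * l)"
  proof (intro AE_I2)
    fix l :: real
    have "(\<lambda>n. complex_of_real (1 / real (Suc n))) \<longlonglongrightarrow> of_real 0"
      by (intro tendsto_of_real LIMSEQ_Suc[OF lim_1_over_n[where 'a = real]])
    then have "(\<lambda>n. exp (- (of_real (1 / real (Suc n)) - \<i> * of_real t) * of_real l) * of_real l ^ 0)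
      \<longlonglongrightarrow> exp (- (of_real 0 - \<i> * of_real t) * of_real l) * of_real l ^ 0"
      by (intro tendsto_exp tendsto_mult tendsto_diff tendsto_minus tendsto_const)
    then show "(\<lambda>n. exp (- (of_real (1 / real (Suc n)) - \<i> * of_real t) * of_real l) * of_real l ^ 0)
      \<longlonglongrightarrow> iexp (t * l)"
      by (simp add: mult.assoc)
  qed
  show "AE l in M. norm (exp (- (of_real (1 / real (Suc n)) - \<i> * of_real t) * of_real l) * of_real l ^ 0) \<le> 1" for n
    using space_on_positives[OF sets] by (intro AE_I2) (auto simp: algebra_simps)
qed (rule borel_measurable_on_positives[OF sets], measurable)+

lemma prob_measure_eq_if_poisson_mixtures_eq:
  fixes M N :: "real measure"
  assumes M: "prob_space M" "sets M = sets (restrict_space borel {0<..})"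
    and N: "prob_space N" "sets N = sets (restrict_space borel {0<..})"
    and eq: "\<And>x::nat. (LINT l|M. exp (-l) * l ^ x / fact x) = (LINT l|N. exp (-l) * l ^ x / fact x)"
  shows "M = N"
proof -
  have finM: "finite_measure M" and finN: "finite_measure N"
    using M(1) N(1) by (simp_all add: prob_space_def)
  have mom: "laplace_moment L 1 x = of_real (fact x * (LINT l|L. exp (-l) * l ^ x / fact x))"
    for x and L :: "real measure"
  proof -
    have "laplace_moment L 1 x = (CLINT l|L. of_real (exp (-l) * l ^ x))"
      by (simp add: laplace_moment_def flip: exp_of_real)
    also have "\<dots> = of_real (LINT l|L. exp (-l) * l ^ x)"
      by (rule integral_complex_of_real)
    finally show ?thesis by simp
  qed
  have "laplace_moment M 1 x = laplace_moment N 1 x" for x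
    by (simp only: mom eq)
  then have lap: "laplace_moment M z x = laplace_moment N z x" if "Re z > 0" for z x
    by (rule laplace_moment_eq_everywhere[OF finM M(2) finN N(2) _ that])
  have chareq: "(CLINT l|M. iexp (t * l)) = (CLINT l|N. iexp (t * l))" for t
  proof (rule LIMSEQ_unique[OF laplace_moment_tendsto_characteristic[OF finM M(2)]])
    show "(\<lambda>n. laplace_moment M (of_real (1 / real (Suc n)) - \<i> * of_real t) 0)
        \<longlonglongrightarrow> (CLINT l|N. iexp (t * l))"
      using laplace_moment_tendsto_characteristic[OF finN N(2), of t] by (subst lap) auto
  qed
  \<comment> \<open>Levy's theorem concerns measures on the whole line, so both measures are pushed forward
    along the inclusion of the positive half-line.\<close>
  have id: "id \<in> borel_measurable L" if "sets L = sets (restrict_space borel {0<..})" for L :: "real measure"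
    by (rule borel_measurable_on_positives[OF that]) simp
  have rd: "real_distribution (distr L borel id)"
    if "prob_space L" "sets L = sets (restrict_space borel {0<..})" for L :: "real measure"
    using prob_space.prob_space_distr[OF that(1) id[OF that(2)]]
    by (simp add: real_distribution_def real_distribution_axioms_def)
  have ch: "char (distr L borel id) t = (CLINT l|L. iexp (t * l))"
    if "sets L = sets (restrict_space borel {0<..})" for L t
    unfolding char_def by (subst integral_distr[OF id[OF that]]) auto
  have "distr M borel id = distr N borel id"
    by (rule Levy_uniqueness[OF rd[OF M] rd[OF N]]) (simp only: fun_eq_iff ch M(2) N(2) chareq, simp)
  show ?thesis
  proof (rule measure_eqI)
    fix A assume "A \<in> sets M"
    then have A: "A \<in> sets borel" "A \<subseteq> {0<..}"
      unfolding M(2) by (auto simp: sets_restrict_space)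
    have "emeasure L A = emeasure (distr L borel id) A"
      if "sets L = sets (restrict_space borel {0<..})" for L :: "real measure"
      using A space_on_positives[OF that]
      by (subst emeasure_distr[OF id[OF that] A(1)]) (auto intro!: arg_cong2[where f = emeasure])
    from this[OF M(2)] this[OF N(2)] \<open>distr M borel id = distr N borel id\<close>
    show "emeasure M A = emeasure N A" by simp
  qed (simp add: M N)
qed

section \<open>The Zeta distribution as a Poisson mixture\<close>

lemma nn_integral_mixing_distribution:
  assumes [measurable]: "f \<in> borel_measurable borel" "g \<in> borel_measurable borel"
    and "\<And>l. 0 \<le> f l"
  shows "(\<integral>\<^sup>+l. g l \<partial>density (restrict_space lborel {0<..}) (\<lambda>l. ennreal (f l)))
    = (\<integral>\<^sup>+l. ennreal (indicator {0::real<..} l * f l) * g l \<partial>lborel)"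
proof -
  have m: "h \<in> borel_measurable (restrict_space lborel {0<..})" if "h \<in> borel_measurable borel"
    for h :: "real \<Rightarrow> ennreal"
    using that by (intro measurable_restrict_space1) simp
  show ?thesis
    by (subst nn_integral_density, (rule m; measurable)+, subst nn_integral_restrict_space)
       (auto intro!: nn_integral_cong split: split_indicator)
qed

theorem mainTheorem4:
  fixes s :: real
  assumes "s > 1"
  shows "(\<forall>l>0. set_integrable lborel {0<..} (zeta_mixing_integrand s l)) \<and>
    is_pdf_on {0<..} (zeta_mixing_density s) \<and>
    (\<forall>x::nat. (LINT l:{0<..}|lborel. pmf (poisson_pmf l) x * zeta_mixing_density s l)
        = pmf (zeta_pmf s) x) \<and>
    (\<forall>x::nat. (LINT l:{0<..}|lborel. exp (-l) * l ^ x / fact x * zeta_mixing_density s l)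
        = real (x + 1) powr (-s) / real_zeta s) \<and>
    (\<forall>\<mu> :: real measure.
        prob_space \<mu> \<longrightarrow>
        sets \<mu> = sets (restrict_space borel {0<..}) \<longrightarrow>
        (\<forall>x::nat. (LINT l|\<mu>. exp (-l) * l ^ x / fact x)
            = real (x + 1) powr (-s) / real_zeta s) \<longrightarrow>
        \<mu> = density (restrict_space lborel {0<..}) (\<lambda>l. ennreal (zeta_mixing_density s l)))"
proof (intro conjI allI impI)
  show "set_integrable lborel {0<..} (zeta_mixing_integrand s l)" if "l > 0" for l
    using assms that by (intro set_integrable_mixing_integrand) auto
  show "is_pdf_on {0<..} (zeta_mixing_density s)"
    by (rule is_pdf_on_zeta_mixing_density[OF assms])
  show mix: "(LINT l:{0<..}|lborel. exp (-l) * l ^ x / fact x * zeta_mixing_density s l)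
        = real (x + 1) powr (-s) / real_zeta s" for x
    by (rule poisson_mixture_integral[OF assms])
  have "(LINT l:{0<..}|lborel. pmf (poisson_pmf l) x * zeta_mixing_density s l)
      = (LINT l:{0<..}|lborel. exp (-l) * l ^ x / fact x * zeta_mixing_density s l)" for x
    by (intro set_lebesgue_integral_cong) auto
  then show "(LINT l:{0<..}|lborel. pmf (poisson_pmf l) x * zeta_mixing_density s l)
        = pmf (zeta_pmf s) x" for x
    unfolding pmf_zeta[OF assms] by (rule trans[OF _ mix])
  fix \<mu> :: "real measure"
  assume \<mu>: "prob_space \<mu>" "sets \<mu> = sets (restrict_space borel {0<..})"
    and "\<forall>x::nat. (LINT l|\<mu>. exp (-l) * l ^ x / fact x) = real (x + 1) powr (-s) / real_zeta s"
  define \<nu> where "\<nu> = density (restrict_space lborel {0<..}) (\<lambda>l. ennreal (zeta_mixing_density s l))"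
  note [measurable] = measurable_zeta_mixing_density[OF assms]
  note nn = zeta_mixing_density_nonneg[OF assms]
  have \<nu>_sets: "sets \<nu> = sets (restrict_space borel {0<..})"
    by (simp add: \<nu>_def sets_restrict_space)
  have \<nu>_nn: "(\<integral>\<^sup>+l. g l \<partial>\<nu>) = (\<integral>\<^sup>+l. ennreal (indicator {0<..} l * zeta_mixing_density s l) * g l \<partial>lborel)"
    if "g \<in> borel_measurable borel" for g
    unfolding \<nu>_def by (rule nn_integral_mixing_distribution) (use that nn in auto)
  have \<nu>_prob: "prob_space \<nu>"
  proof
    have "emeasure \<nu> (space \<nu>) = (\<integral>\<^sup>+l. 1 \<partial>\<nu>)" by simp
    also have "\<dots> = 1"
      by (subst \<nu>_nn) (simp_all add: nn_integral_zeta_mixing_density[OF assms])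
    finally show "emeasure \<nu> (space \<nu>) = 1" .
  qed
  have "(LINT l|\<nu>. exp (-l) * l ^ x / fact x) = real (x + 1) powr (-s) / real_zeta s" for x
  proof -
    have "(\<integral>\<^sup>+l. ennreal (exp (-l) * l ^ x / fact x) \<partial>\<nu>)
        = (\<integral>\<^sup>+l. ennreal (indicator {0<..} l *
            (exp (-l) * l ^ x / fact x * zeta_mixing_density s l)) \<partial>lborel)"
      by (subst \<nu>_nn, measurable, intro nn_integral_cong)
        (auto simp: ennreal_mult''[symmetric] nn mult.commute split: split_indicator)
    also have "\<dots> = ennreal (real (x + 1) powr (-s) / real_zeta s)"
      by (rule nn_integral_poisson_mixture[OF assms])
    finally have I: "(\<integral>\<^sup>+l. ennreal (exp (-l) * l ^ x / fact x) \<partial>\<nu>)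
        = ennreal (real (x + 1) powr (-s) / real_zeta s)" .
    have "has_bochner_integral \<nu> (\<lambda>l. exp (-l) * l ^ x / fact x)
        (real (x + 1) powr (-s) / real_zeta s)"
    proof (rule has_bochner_integral_nn_integral[OF _ _ _ I])
      show "AE l in \<nu>. 0 \<le> exp (-l) * l ^ x / fact x"
        using space_on_positives[OF \<nu>_sets] by (intro AE_I2) simp
      show "0 \<le> real (x + 1) powr (-s) / real_zeta s"
        using real_zeta_pos[OF assms] by simp
    qed (rule borel_measurable_on_positives[OF \<nu>_sets], measurable)
    then show ?thesis
      by (rule has_bochner_integral_integral_eq)
  qed
  then show "\<mu> = density (restrict_space lborel {0<..}) (\<lambda>l. ennreal (zeta_mixing_density s l))"
    unfolding \<nu>_def[symmetric] using \<open>\<forall>x::nat. _\<close>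
    by (intro prob_measure_eq_if_poisson_mixtures_eq \<mu> \<nu>_prob \<nu>_sets) auto
qed

end
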